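(* Let $\mathcal{F}=\{\mathcal{D}_j\}_{j\in I}$ be a finite family of probability distributions with densities $f_j:[0,\infty)\to[0,\infty)$ such that each $f_j$ is $\alpha_j$-Hölder continuous for some $0<\alpha_j\le1$ and is supported only on $[0,1]$. Then $\mathcal{F}$ satisfies the Mellin transform condition for every base $B>1$: uniformly over all functions $p:\mathbb{Z}_{>0}\to I$, $$\lim_{n\to\infty}\ \sum_{\ell\in\mathbb{Z},\,\ell\ne0}\ \prod_{m=1}^{n}\mathcal{M}f_{p(m)}\!\left(1-\frac{2\pi i\ell}{\log B}\right)=0 .$$ In particular, for such $\mathcal{F}$, products of independent random variables distributed according to any sequence of the $f_j$ approach Benford behavior, at a rate uniform over all such sequences: for every $s\in[1,B)$, $$\lim_{n\to\infty}\ \sup_{p}\ \left|\mathbb{P}\big(S_B(X^{p}_1X^{p}_2\cdots X^{p}_n)\le s\big)-\log_B s\right|=0,$$ where the supremum is over all $p:\mathbb{Z}_{>0}\to I$ and $X^p_1,X^p_2,\dots$ are independent with $X^p_m\sim\mathcal{D}_{p(m)}$.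
   Context: $\log$ is the natural logarithm. The Mellin transform of a continuous function $f:[0,\infty)\to\mathbb{R}$ is $\mathcal{M}f(z)=\int_0^\infty f(x)x^{z}\,\frac{dx}{x}$. For $B>1$, the significand $S_B(x)\in[1,B)$ of $x>0$ is defined by $x=S_B(x)B^{j}$ with $j\in\mathbb{Z}$. A positive random variable $X$ is Benford base $B$ if $\mathbb{P}(S_B(X)\le s)=\log_B s$ for all $s\in[1,B)$. *)

theory Defs
  imports "HOL-Probability.Probability"
begin

definition holder_continuous_on :: "real \<Rightarrow> real set \<Rightarrow> (real \<Rightarrow> real) \<Rightarrow> bool" where
  "holder_continuous_on \<alpha> S f \<longleftrightarrow>
     (\<exists>C\<ge>0. \<forall>x\<in>S. \<forall>y\<in>S. \<bar>f x - f y\<bar> \<le> C * \<bar>x - y\<bar> powr \<alpha>)"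

text \<open>A density \<open>f : [0,\<infinity>) \<rightarrow> [0,\<infinity>)\<close> is represented by a function on all reals whose
  values at negative arguments are irrelevant; the indicator discards them. That the measure
  has total mass 1 is part of this predicate.\<close>

definition has_density_on_nonneg :: "real measure \<Rightarrow> (real \<Rightarrow> real) \<Rightarrow> bool" where
  "has_density_on_nonneg D f \<longleftrightarrow>
     prob_space D \<and> set_borel_measurable borel {0..} f \<and> (\<forall>x\<ge>0. f x \<ge> 0) \<and>
     D = density lborel (\<lambda>x. ennreal (indicator {0..} x * f x))"

definition mellin :: "(real \<Rightarrow> real) \<Rightarrow> complex \<Rightarrow> complex" where
  "mellin f z =
     (LINT x:{0<..}|lborel. of_real (f x) * of_real x powr z / of_real x)"

text \<open>For \<open>B > 1\<close> and \<open>x > 0\<close> the description below is uniquely satisfied. For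
  \<open>x \<le> 0\<close> no \<open>s\<close> satisfies it, so the significand is then an unspecified constant; this
  only concerns an event of probability 0 in the application.\<close>

definition significand :: "real \<Rightarrow> real \<Rightarrow> real" where
  "significand B x = (THE s. s \<in> {1..<B} \<and> (\<exists>j::int. x = s * B powi j))"

text \<open>The functions \<open>p\<close> from the positive integers to \<open>I\<close> are the elements of
  \<open>{1..} \<rightarrow>\<^sub>E I\<close>. For small \<open>n\<close> the series over \<open>\<ell>\<close> need not converge, and
  \<open>infsum\<close> is 0 for a non-summable family, so (absolute) convergence for all large \<open>n\<close>,
  uniformly in \<open>p\<close>, is demanded explicitly.\<close>

definition mellin_transform_condition ::
    "real \<Rightarrow> 'i set \<Rightarrow> ('i \<Rightarrow> real \<Rightarrow> real) \<Rightarrow> bool" where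
  "mellin_transform_condition B I f \<longleftrightarrow>
     (let c = (\<lambda>n (p :: nat \<Rightarrow> 'i) (l :: int).
                 \<Prod>m=1..n. mellin (f (p m)) (1 - 2 * of_real pi * \<i> * of_int l / of_real (ln B)))
      in (\<forall>\<^sub>F n in sequentially. \<forall>p \<in> {1..} \<rightarrow>\<^sub>E I. c n p summable_on {l. l \<noteq> 0}) \<and>
         uniform_limit ({1..} \<rightarrow>\<^sub>E I) (\<lambda>n p. \<Sum>\<^sub>\<infinity>l | l \<noteq> 0. c n p l) (\<lambda>p. 0) sequentially)"

definition independent_sequence_with_laws ::
    "'a measure \<Rightarrow> (nat \<Rightarrow> 'a \<Rightarrow> real) \<Rightarrow> (nat \<Rightarrow> real measure) \<Rightarrow> bool" where
  "independent_sequence_with_laws M X \<mu> \<longleftrightarrow>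
     prob_space M \<and> prob_space.indep_vars M (\<lambda>m. borel) X {1..} \<and>
     (\<forall>m\<ge>1. distr M borel (X m) = \<mu> m)"

end

theory Submission
  imports Defs
begin

text \<open>
  On the line \<open>Re z = 1\<close> the Mellin transform of a density is an oscillatory integral:
  \<open>mellin f (1 - \<i> \<tau>)\<close> is the integral of \<open>f x\<close> against \<open>cis (- \<tau> ln x)\<close>, that is, a value of the
  characteristic function of the logarithm of a random variable with density \<open>f\<close>. Two
  bounds on it carry everything.

  Decay (\<open>norm_oscillatory_integral_le\<close>): scaling \<open>x\<close> by \<open>q = exp (\<pi> / \<bar>\<tau>\<bar>)\<close> flips the sign of the
  oscillating factor, so twice the integral is the integral of \<open>f x - q f (q x)\<close> against the same
  factor. As \<open>q\<close> is close to 1 for large \<open>\<tau>\<close>, Hoelder continuity on the bounded support makes this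
  \<open>O(\<bar>\<tau>\<bar> powr - \<alpha>)\<close>.

  Strictness (\<open>norm_oscillatory_integral_less_1\<close>): for \<open>\<tau> \<noteq> 0\<close> the modulus is below 1, since equality
  in the triangle inequality would concentrate the density on a countable level set of
  \<open>cis (\<tau> ln x)\<close>.

  Decay leaves only finitely many frequencies at which the modulus could exceed 1/2, and the
  family is finite, so all moduli at nonzero frequencies lie below one constant \<open>\<rho> < 1\<close>. In a
  product of \<open>n\<close> transforms, spend a fixed number \<open>N\<close> of factors on decay, so as to get a summable
  bound \<open>const / l\<^sup>2\<close>, and bound the remaining ones by \<open>\<rho>\<close>: the series is
  \<open>O(\<rho> ^ (n - N))\<close>, whatever the sequence \<open>p\<close> is.

  For the Benford statement, \<open>significand B x \<le> s\<close> says that the fractional part of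
  \<open>log B x\<close> is at most \<open>log B s\<close>. By independence, the Fourier coefficients of
  \<open>log B (X\<^sub>1 \<dots> X\<^sub>n)\<close> modulo 1 are exactly the products above, hence at most \<open>\<rho> ^ n\<close> in modulus. A
  Weyl criterion that is uniform over all probability measures (\<open>arc_measure_lower_bound\<close>) turns
  the smallness of finitely many Fourier coefficients into closeness to the uniform law. It gives
  lower bounds for open arcs; applied to the arc from 0 to \<open>log B s\<close> and to the
  complementary one it bounds the distribution function from both sides.
\<close>

section \<open>Oscillatory integrals on the multiplicative half-line\<close>

lemma mellin_on_line_eq:
  "mellin f (1 - \<i> * of_real \<tau>) =
     (LINT x|lborel. (indicator {0<..} x * f x) *\<^sub>R cis (- \<tau> * ln x))"
proof -
  have "complex_of_real x powr (1 - \<i> * of_real \<tau>) / of_real x = cis (- \<tau> * ln x)"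
    if "x > 0" for x
    using that
    by (simp add: powr_def cis_conv_exp exp_diff Ln_of_real ring_distribs mult_ac exp_minus
        exp_of_real divide_inverse)
  then show ?thesis
    unfolding mellin_def set_lebesgue_integral_def
    by (intro Bochner_Integration.integral_cong)
       (auto simp: indicator_def scaleR_conv_of_real simp flip: times_divide_eq_right)
qed

lemma integrable_scaleR_cis:
  fixes g h :: "real \<Rightarrow> real"
  assumes "integrable lborel g" and [measurable]: "h \<in> borel_measurable borel"
  shows "integrable lborel (\<lambda>x. g x *\<^sub>R cis (h x))"
proof (rule Bochner_Integration.integrable_bound[OF assms(1)])
  have [measurable]: "g \<in> borel_measurable borel" using assms(1) by auto
  show "(\<lambda>x. g x *\<^sub>R cis (h x)) \<in> borel_measurable lborel"
    by (simp add: cis_conv_exp)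
qed auto

text \<open>
  This is the multiplicative form of the classical proof of the Riemann--Lebesgue lemma with a
  rate, where one translates by half a period. Here the translation is \<open>x \<mapsto> q x\<close>, which adds
  \<open>\<plusminus> \<pi>\<close> to the phase. Splitting
  \<open>g x - q g (q x)\<close> as \<open>(g x - g (q x)) - (q - 1) g (q x)\<close> separates the modulus of continuity
  from the change of volume; the latter has integral at most \<open>q - 1\<close> because \<open>g\<close> has mass 1.
  Since \<open>q > 1\<close>, a point to the right of the support is scaled to another such point, so
  that the difference lives on \<open>{0..1}\<close>.
\<close>
lemma norm_oscillatory_integral_le:
  fixes g :: "real \<Rightarrow> real"
  assumes g: "integrable lborel g" "\<And>x. 0 \<le> g x" "(LINT x|lborel. g x) = 1"
    and supp: "\<And>x. x \<le> 0 \<Longrightarrow> g x = 0" "\<And>x. x > 1 \<Longrightarrow> g x = 0"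
    and holder: "\<And>x y. 0 < x \<Longrightarrow> 0 < y \<Longrightarrow> \<bar>g x - g y\<bar> \<le> C * \<bar>x - y\<bar> powr \<alpha>"
    and C: "0 \<le> C" "0 < \<alpha>" and \<tau>: "\<tau> \<noteq> 0"
  defines "q \<equiv> exp (pi / \<bar>\<tau>\<bar>)"
  shows "2 * norm (LINT x|lborel. g x *\<^sub>R cis (\<tau> * ln x)) \<le> C * (q - 1) powr \<alpha> + (q - 1)"
proof -
  have q: "q > 1" using \<tau> by (simp add: q_def)
  let ?M = "LINT x|lborel. g x *\<^sub>R cis (\<tau> * ln x)"
  have flip: "cis (\<tau> * ln (q * x)) = - cis (\<tau> * ln x)" if "x > 0" for x
  proof -
    have "\<tau> * ln (q * x) = \<tau> * ln x + sgn \<tau> * pi"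
      using that \<tau> q by (simp add: ln_mult q_def ring_distribs sgn_if)
    moreover have "cis (sgn \<tau> * pi) = -1" using \<tau> by (auto simp: sgn_if simp flip: cis_cnj)
    ultimately show ?thesis by (simp flip: cis_mult)
  qed
  have int_q: "integrable lborel (\<lambda>x. g (q * x))"
    using lborel_integrable_real_affine[OF g(1), of q 0] q by simp
  have int_q_eq: "q * (LINT x|lborel. g (q * x)) = 1"
    using lborel_integral_real_affine[of q g 0] q g(3) by simp
  have "?M = q *\<^sub>R (LINT x|lborel. g (q * x) *\<^sub>R cis (\<tau> * ln (q * x)))"
    using lborel_integral_real_affine[of q "\<lambda>x. g x *\<^sub>R cis (\<tau> * ln x)" 0] q by simp
  also have "\<dots> = (LINT x|lborel. - ((q * g (q * x)) *\<^sub>R cis (\<tau> * ln x)))"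
    unfolding integral_scaleR_right[symmetric]
  proof (rule Bochner_Integration.integral_cong)
    fix x
    show "q *\<^sub>R g (q * x) *\<^sub>R cis (\<tau> * ln (q * x)) = - ((q * g (q * x)) *\<^sub>R cis (\<tau> * ln x))"
      using flip[of x] supp(1)[of "q * x"] q by (cases "x > 0") (auto simp: mult_le_0_iff)
  qed simp
  finally have "2 * ?M =
      (LINT x|lborel. g x *\<^sub>R cis (\<tau> * ln x)) + (LINT x|lborel. - ((q * g (q * x)) *\<^sub>R cis (\<tau> * ln x)))"
    by simp
  also have "\<dots> = (LINT x|lborel. (g x - q * g (q * x)) *\<^sub>R cis (\<tau> * ln x))"
    using integrable_scaleR_cis[OF g(1), of "\<lambda>x. \<tau> * ln x"]
      integrable_scaleR_cis[OF integrable_mult_right[OF int_q, of q], of "\<lambda>x. \<tau> * ln x"]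
    by (subst Bochner_Integration.integral_add[symmetric]) (auto simp: algebra_simps)
  finally have "2 * norm ?M = norm (LINT x|lborel. (g x - q * g (q * x)) *\<^sub>R cis (\<tau> * ln x))"
    by (metis norm_mult norm_numeral)
  also have "\<dots> \<le> (LINT x|lborel. indicator {0..1} x * (C * (q - 1) powr \<alpha>) + (q - 1) * g (q * x))"
  proof (rule Bochner_Integration.integral_norm_bound_integral)
    show "integrable lborel (\<lambda>x. (g x - q * g (q * x)) *\<^sub>R cis (\<tau> * ln x))"
      using g(1) int_q by (intro integrable_scaleR_cis) auto
    show "integrable lborel (\<lambda>x. indicator {0..1} x * (C * (q - 1) powr \<alpha>) + (q - 1) * g (q * x))"
      using int_q by (intro Bochner_Integration.integrable_add integrable_mult_right integrable_mult_left)
        auto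
    fix x
    have "\<bar>g x - q * g (q * x)\<bar> = \<bar>(g x - g (q * x)) - (q - 1) * g (q * x)\<bar>"
      by (simp add: algebra_simps)
    also have "\<dots> \<le> \<bar>g x - g (q * x)\<bar> + (q - 1) * g (q * x)"
      using abs_triangle_ineq4[of "g x - g (q * x)" "(q - 1) * g (q * x)"] q g(2)[of "q * x"]
      by (simp add: abs_mult)
    also have "\<bar>g x - g (q * x)\<bar> \<le> indicator {0..1} x * (C * (q - 1) powr \<alpha>)"
    proof -
      consider "x \<le> 0" | "x > 1" | "0 < x" "x \<le> 1" by linarith
      then show ?thesis
      proof cases
        case 1
        then have "q * x \<le> 0" using q by (simp add: mult_le_0_iff)
        then show ?thesis using 1 supp(1) C by (simp add: indicator_def)
      next
        case 2
        then have "q * x > 1" using q by (metis less_1_mult)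
        then show ?thesis using 2 supp(2) by simp
      next
        case 3
        have "\<bar>g x - g (q * x)\<bar> \<le> C * \<bar>x - q * x\<bar> powr \<alpha>" using 3 q by (intro holder) auto
        also have "\<bar>x - q * x\<bar> = (q - 1) * x"
        proof -
          have "x - q * x = - ((q - 1) * x)" by (simp add: algebra_simps)
          then show ?thesis using q 3 by (simp add: abs_mult)
        qed
        also have "C * ((q - 1) * x) powr \<alpha> \<le> C * (q - 1) powr \<alpha>"
          using 3 q C by (intro mult_left_mono powr_mono2) (auto simp: mult_le_cancel_left1)
        finally show ?thesis using 3 by simp
      qed
    qed
    finally show "norm ((g x - q * g (q * x)) *\<^sub>R cis (\<tau> * ln x))
        \<le> indicator {0..1} x * (C * (q - 1) powr \<alpha>) + (q - 1) * g (q * x)"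
      by simp
  qed
  also have "\<dots> = C * (q - 1) powr \<alpha> + (q - 1) * (LINT x|lborel. g (q * x))"
    using int_q by (subst Bochner_Integration.integral_add) auto
  also have "(q - 1) * (LINT x|lborel. g (q * x)) \<le> q - 1"
  proof -
    have "(LINT x|lborel. g (q * x)) = 1 / q" using int_q_eq q by (simp add: field_simps)
    then show ?thesis using q mult_left_mono[of "1 / q" 1 "q - 1"] by simp
  qed
  finally show ?thesis by simp
qed

lemma countable_level_set_cis_ln:
  assumes "\<tau> \<noteq> 0"
  shows "countable {x. 0 < x \<and> cis (\<tau> * ln x) = w}"
proof (cases "{x. 0 < x \<and> cis (\<tau> * ln x) = w} = {}")
  case False
  then obtain y where y: "0 < y" "cis (\<tau> * ln y) = w" by auto
  have "{x. 0 < x \<and> cis (\<tau> * ln x) = w} \<subseteq> range (\<lambda>k::int. y * exp (2 * pi * k / \<tau>))"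
  proof clarify
    fix x :: real
    assume x: "0 < x" "w = cis (\<tau> * ln x)"
    then have "cis (\<tau> * ln x - \<tau> * ln y) = 1" using y by (simp flip: cis_divide)
    then have "cos (\<tau> * ln x - \<tau> * ln y) = 1" by (simp add: complex_eq_iff)
    then obtain k :: int where "\<tau> * ln x - \<tau> * ln y = of_int k * (2 * pi)"
      unfolding cos_one_2pi_int by auto
    then have "ln x = ln y + 2 * pi * k / \<tau>" using assms by (simp add: field_simps)
    then have "x = y * exp (2 * pi * k / \<tau>)" using x y by (metis exp_add exp_ln)
    then show "x \<in> range (\<lambda>k::int. y * exp (2 * pi * k / \<tau>))" by auto
  qed
  then show ?thesis by (rule countable_subset) auto
next
  case True
  then show ?thesis by (metis countable_empty)
qed

text \<open>
  If the modulus were 1, rotate the integral to the value 1. Then \<open>g x - Re (w * h x)\<close> is a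
  nonnegative function with integral 0, so almost everywhere \<open>g\<close> vanishes or the
  phase is constant. The phase takes each value only countably often, hence \<open>g\<close> would vanish
  almost everywhere.
\<close>
lemma norm_oscillatory_integral_less_1:
  fixes g :: "real \<Rightarrow> real"
  assumes g: "integrable lborel g" "\<And>x. 0 \<le> g x" "(LINT x|lborel. g x) = 1"
    and supp: "\<And>x. x \<le> 0 \<Longrightarrow> g x = 0" and \<tau>: "\<tau> \<noteq> 0"
  shows "norm (LINT x|lborel. g x *\<^sub>R cis (\<tau> * ln x)) < 1"
proof -
  let ?h = "\<lambda>x. g x *\<^sub>R cis (\<tau> * ln x)"
  let ?M = "LINT x|lborel. ?h x"
  have int: "integrable lborel ?h" using g(1) by (intro integrable_scaleR_cis) auto
  have "norm ?M \<noteq> 1"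
  proof
    assume M: "norm ?M = 1"
    \<comment> \<open>The rotation that makes the integral real and positive.\<close>
    define w where "w = cnj ?M"
    have nw: "norm w = 1" using M by (simp add: w_def)
    have wM: "w * ?M = 1"
      using complex_norm_square[of ?M] M by (simp add: w_def mult.commute)
    have int_w: "integrable lborel (\<lambda>x. w * ?h x)" using int by (rule integrable_mult_right)
    have "(LINT x|lborel. Re (w * ?h x)) = Re (w * ?M)"
      by (metis integral_Re[OF int_w] integral_mult_right_zero)
    then have "(LINT x|lborel. g x - Re (w * ?h x)) = 0"
      using integrable_Re[OF int_w] g(1,3) wM by (subst Bochner_Integration.integral_diff) auto
    moreover have nonneg: "Re (w * ?h x) \<le> g x" for x
      using complex_Re_le_cmod[of "w * ?h x"] nw g(2)[of x] by (simp add: norm_mult)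
    moreover have "integrable lborel (\<lambda>x. g x - Re (w * ?h x))"
      by (intro Bochner_Integration.integrable_diff g(1) integrable_Re[OF int_w])
    ultimately have AE1: "AE x in lborel. g x - Re (w * ?h x) = 0"
      by (subst (asm) integral_nonneg_eq_0_iff_AE) auto
    let ?E = "{x. 0 < x \<and> cis (\<tau> * ln x) = cnj w}"
    have "?E \<in> null_sets lborel"
      using countable_level_set_cis_ln[OF \<tau>] by (rule countable_imp_null_set_lborel)
    then have AE2: "AE x in lborel. x \<notin> ?E" by (rule AE_not_in)
    have "AE x in lborel. g x = 0"
      using AE1 AE2
    proof eventually_elim
      case (elim x)
      show "g x = 0"
      proof (rule ccontr)
        assume gx: "g x \<noteq> 0"
        then have "0 < x" using supp[of x] by force
        have "g x * Re (w * cis (\<tau> * ln x)) = g x * 1" using elim(1) by (simp add: algebra_simps)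
        then have 1: "Re (w * cis (\<tau> * ln x)) = 1" using gx by simp
        moreover have n: "norm (w * cis (\<tau> * ln x)) = 1" using nw by (simp add: norm_mult)
        ultimately have "Im (w * cis (\<tau> * ln x)) = 0"
          using cmod_power2[of "w * cis (\<tau> * ln x)"] by simp
        then have "w * cis (\<tau> * ln x) = 1" using 1 by (simp add: complex_eq_iff)
        then have "cnj w * (w * cis (\<tau> * ln x)) = cnj w" by simp
        moreover have "cnj w * w = 1" using complex_norm_square[of w] nw by (simp add: mult.commute)
        ultimately have "cis (\<tau> * ln x) = cnj w" by (metis mult.assoc mult_1)
        with \<open>0 < x\<close> elim(2) show False by simp
      qed
    qed
    then have "(LINT x|lborel. g x) = 0" by (rule integral_eq_zero_AE)
    with g(3) show False by simp
  qed
  moreover have "norm ?M \<le> (LINT x|lborel. norm (?h x))" by (rule integral_norm_bound)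
  ultimately show ?thesis using g by auto
qed

section \<open>Uniform bounds and the Mellin transform condition\<close>

abbreviation mellin_coeff :: "real \<Rightarrow> (real \<Rightarrow> real) \<Rightarrow> int \<Rightarrow> complex" where
  "mellin_coeff B f l \<equiv> mellin f (1 - 2 * of_real pi * \<i> * of_int l / of_real (ln B))"

text \<open>
  The point 0 carries no mass, and the logarithm in the phase is meaningful only for \<open>x > 0\<close>, so
  the density is cut off to the open half-line once and for all.
\<close>
lemma positive_part_of_density:
  assumes "has_density_on_nonneg D f"
  defines "g \<equiv> \<lambda>x. indicator {0<..} x * f x"
  shows "integrable lborel g" "\<And>x. 0 \<le> g x" "(LINT x|lborel. g x) = 1"
    "D = density lborel (\<lambda>x. ennreal (g x))"
proof -
  have f: "prob_space D" "(\<lambda>x. indicator {0..} x * f x) \<in> borel_measurable borel" "\<And>x. x \<ge> 0 \<Longrightarrow> f x \<ge> 0"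
    and D: "D = density lborel (\<lambda>x. ennreal (indicator {0..} x * f x))"
    using assms(1) by (auto simp: has_density_on_nonneg_def set_borel_measurable_def)
  note [measurable] = f(2)
  have "g = (\<lambda>x. indicator {0<..} x * (indicator {0..} x * f x))"
    by (rule ext) (simp add: g_def indicator_def)
  then have [measurable]: "g \<in> borel_measurable borel" by simp
  show pos: "0 \<le> g x" for x using f(3)[of x] by (simp add: g_def indicator_def)
  have "AE x in lborel. x \<noteq> (0::real)" by (rule AE_lborel_singleton)
  then show D': "D = density lborel (\<lambda>x. ennreal (g x))"
    unfolding D
  proof (intro density_cong)
    show "AE x in lborel. ennreal (indicator {0..} x * f x) = ennreal (g x)"
      using \<open>AE x in lborel. x \<noteq> (0::real)\<close>
      by eventually_elim (auto simp: g_def indicator_def)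
  qed measurable
  have "emeasure D (space D) = (\<integral>\<^sup>+x. ennreal (g x) \<partial>lborel)"
    unfolding D' by (simp add: emeasure_density)
  then have nn: "(\<integral>\<^sup>+x. ennreal (g x) \<partial>lborel) = ennreal 1"
    using prob_space.emeasure_space_1[OF f(1)] by simp
  show "integrable lborel g"
    using nn pos by (intro integrableI_nonneg) auto
  show "(LINT x|lborel. g x) = 1"
    using nn pos by (subst integral_eq_nn_integral) auto
qed

lemma mellin_coeff_eq:
  "mellin_coeff B f l =
     (LINT x|lborel. (indicator {0<..} x * f x) *\<^sub>R cis (- (2 * pi * of_int l / ln B) * ln x))"
proof -
  have "1 - 2 * of_real pi * \<i> * of_int l / of_real (ln B) =
      1 - \<i> * complex_of_real (2 * pi * of_int l / ln B)" by simp
  then show ?thesis using mellin_on_line_eq[of f "2 * pi * of_int l / ln B"] by metis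
qed

lemma norm_mellin_coeff_less_1:
  assumes "has_density_on_nonneg D f" "B > 1" "l \<noteq> 0"
  shows "norm (mellin_coeff B f l) < 1"
  unfolding mellin_coeff_eq using assms
  by (intro norm_oscillatory_integral_less_1 positive_part_of_density) auto

text \<open>
  At frequency \<open>l\<close> the scaling factor is \<open>q = exp (ln B / (2 \<bar>l\<bar>))\<close>, and \<open>exp y - 1 \<le> y exp y\<close> gives
  \<open>q - 1 \<le> (B ln B / 2) / \<bar>l\<bar>\<close>. Both terms of the bound are then \<open>O(\<bar>l\<bar> powr - \<alpha>)\<close>; for the second,
  linear one this is where \<open>\<alpha> \<le> 1\<close> enters.
\<close>
lemma mellin_coeff_decay:
  assumes dens: "has_density_on_nonneg D f" and \<alpha>: "0 < \<alpha>" "\<alpha> \<le> 1"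
    and hol: "holder_continuous_on \<alpha> {0..} f" and supp: "\<And>x. x > 1 \<Longrightarrow> f x = 0" and B: "B > 1"
  shows "\<exists>K. \<forall>l. l \<noteq> 0 \<longrightarrow> norm (mellin_coeff B f l) \<le> K * \<bar>of_int l\<bar> powr (-\<alpha>)"
proof -
  obtain C where C: "C \<ge> 0" "\<And>x y. 0 \<le> x \<Longrightarrow> 0 \<le> y \<Longrightarrow> \<bar>f x - f y\<bar> \<le> C * \<bar>x - y\<bar> powr \<alpha>"
    using hol unfolding holder_continuous_on_def by (metis atLeast_iff)
  define E where "E = B * ln B / 2"
  have E: "E > 0" using B by (simp add: E_def)
  have "norm (mellin_coeff B f l) \<le> (C * E powr \<alpha> + E) * \<bar>of_int l\<bar> powr (-\<alpha>)" if l: "l \<noteq> 0" for l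
  proof -
    define r where "r = \<bar>real_of_int l\<bar>"
    have r: "r \<ge> 1" using l by (simp add: r_def)
    let ?\<tau> = "- (2 * pi * of_int l / ln B)"
    have \<tau>: "pi / \<bar>?\<tau>\<bar> = ln B / (2 * r)" using B l by (simp add: r_def abs_mult field_simps)
    define y where "y = ln B / (2 * r)"
    have y: "0 < y" "y \<le> ln B" using B r by (auto simp: y_def field_simps)
    have "exp y - 1 \<le> y * exp y"
    proof -
      have "1 - y \<le> exp (- y)" using exp_ge_add_one_self[of "-y"] by simp
      then have "(1 - y) * exp y \<le> exp (-y) * exp y" by (rule mult_right_mono) simp
      then show ?thesis by (simp add: algebra_simps flip: exp_add)
    qed
    also have "\<dots> \<le> y * B" using y B by (intro mult_left_mono) (auto simp: ln_ge_iff)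
    also have "\<dots> = E / r" by (simp add: y_def E_def)
    finally have qE: "exp y - 1 \<le> E / r" .
    have "2 * norm (mellin_coeff B f l) \<le> C * (exp y - 1) powr \<alpha> + (exp y - 1)"
      unfolding mellin_coeff_eq y_def \<tau>[symmetric]
    proof (rule norm_oscillatory_integral_le)
      fix x y :: real assume "0 < x" "0 < y"
      then show "\<bar>indicat_real {0<..} x * f x - indicat_real {0<..} y * f y\<bar> \<le> C * \<bar>x - y\<bar> powr \<alpha>"
        using C(2)[of x y] by simp
    qed (use positive_part_of_density[OF dens] C \<alpha> l B supp in auto)
    also have "\<dots> \<le> C * (E / r) powr \<alpha> + E / r"
      using qE C \<alpha> y by (intro add_mono mult_left_mono powr_mono2) auto
    also have "(E / r) powr \<alpha> = E powr \<alpha> * r powr (-\<alpha>)"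
      using E r by (simp add: powr_divide powr_minus_divide)
    also have "E / r \<le> E * r powr (-\<alpha>)"
    proof -
      have "r powr (-1) \<le> r powr (-\<alpha>)" using r \<alpha> by (intro powr_mono) auto
      then show ?thesis using E r by (simp add: powr_minus_divide field_simps)
    qed
    finally have "2 * norm (mellin_coeff B f l) \<le> (C * E powr \<alpha> + E) * r powr (-\<alpha>)"
      by (simp add: algebra_simps)
    then show ?thesis using norm_ge_zero[of "mellin_coeff B f l"] unfolding r_def by linarith
  qed
  then show ?thesis by blast
qed

lemma finite_small_ints: "finite {l::int. \<bar>real_of_int l\<bar> \<le> R}"
proof (rule finite_subset)
  show "{l::int. \<bar>real_of_int l\<bar> \<le> R} \<subseteq> {-\<lceil>R\<rceil>..\<lceil>R\<rceil>}" by (auto; linarith)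
qed simp

text \<open>
  Finiteness of the family supplies one constant and one exponent for all of its members. Strictness
  alone would give no uniform gap over the infinitely many frequencies; it is decay that
  reduces the gap to a maximum over the finite set \<open>A\<close> of low frequencies.
\<close>
lemma uniform_mellin_coeff_bounds:
  fixes I :: "'i set"
  assumes I: "finite I"
    and dens: "\<And>j. j \<in> I \<Longrightarrow> has_density_on_nonneg (D j) (f j)"
    and \<alpha>: "\<And>j. j \<in> I \<Longrightarrow> 0 < \<alpha> j \<and> \<alpha> j \<le> 1"
    and hol: "\<And>j. j \<in> I \<Longrightarrow> holder_continuous_on (\<alpha> j) {0..} (f j)"
    and supp: "\<And>j x. j \<in> I \<Longrightarrow> x > 1 \<Longrightarrow> f j x = 0"
    and B: "B > 1"
  obtains K \<beta> \<rho> where "0 \<le> K" "0 < \<beta>" "0 < \<rho>" "\<rho> < 1"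
    "\<And>j l. j \<in> I \<Longrightarrow> l \<noteq> 0 \<Longrightarrow> norm (mellin_coeff B (f j) l) \<le> K * \<bar>of_int l\<bar> powr (-\<beta>)"
    "\<And>j l. j \<in> I \<Longrightarrow> l \<noteq> 0 \<Longrightarrow> norm (mellin_coeff B (f j) l) \<le> \<rho>"
proof -
  have "\<forall>j\<in>I. \<exists>K. \<forall>l. l \<noteq> 0 \<longrightarrow> norm (mellin_coeff B (f j) l) \<le> K * \<bar>of_int l\<bar> powr (- \<alpha> j)"
    using mellin_coeff_decay[OF dens _ _ hol supp B] \<alpha> by blast
  then obtain k where k: "\<And>j l. j \<in> I \<Longrightarrow> l \<noteq> 0 \<Longrightarrow>
      norm (mellin_coeff B (f j) l) \<le> k j * \<bar>of_int l\<bar> powr (- \<alpha> j)"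
    by metis
  define K where "K = Max (insert 0 (k ` I))"
  define \<beta> where "\<beta> = Min (insert 1 (\<alpha> ` I))"
  have K: "0 \<le> K" "\<And>j. j \<in> I \<Longrightarrow> k j \<le> K" using I by (auto simp: K_def)
  have \<beta>: "0 < \<beta>" "\<And>j. j \<in> I \<Longrightarrow> \<beta> \<le> \<alpha> j" using I \<alpha> by (auto simp: \<beta>_def)
  have decay: "norm (mellin_coeff B (f j) l) \<le> K * \<bar>of_int l\<bar> powr (-\<beta>)" if "j \<in> I" "l \<noteq> 0" for j l
  proof -
    have "norm (mellin_coeff B (f j) l) \<le> k j * \<bar>of_int l\<bar> powr (- \<alpha> j)" using k that by blast
    also have "\<dots> \<le> K * \<bar>of_int l\<bar> powr (-\<beta>)"
      using K \<beta> that by (intro mult_mono powr_mono) auto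
    finally show ?thesis .
  qed
  have "((\<lambda>x. K * x powr (-\<beta>)) \<longlongrightarrow> K * 0) at_top"
    using \<beta>(1) by (intro tendsto_mult tendsto_const tendsto_neg_powr filterlim_ident) auto
  then have "\<forall>\<^sub>F x in at_top. K * x powr (-\<beta>) < 1 / 2" by (rule order_tendstoD) simp
  then obtain R where R: "\<And>x. x \<ge> R \<Longrightarrow> K * x powr (-\<beta>) < 1 / 2"
    unfolding eventually_at_top_linorder by auto
  define A where "A = I \<times> ({l. \<bar>real_of_int l\<bar> \<le> R} - {0})"
  have A: "finite A" using I finite_small_ints by (auto simp: A_def)
  define \<rho> where "\<rho> = Max (insert (1 / 2) ((\<lambda>(j, l). norm (mellin_coeff B (f j) l)) ` A))"
  have "\<rho> < 1" unfolding \<rho>_def using A dens B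
    by (subst Max_less_iff) (auto simp: A_def intro: norm_mellin_coeff_less_1)
  moreover have half: "1 / 2 \<le> \<rho>" unfolding \<rho>_def using A by (intro Max_ge) auto
  moreover have "norm (mellin_coeff B (f j) l) \<le> \<rho>" if "j \<in> I" "l \<noteq> 0" for j l
  proof (cases "\<bar>real_of_int l\<bar> \<le> R")
    case True
    then have "(j, l) \<in> A" using that by (simp add: A_def)
    then show ?thesis unfolding \<rho>_def using A by (intro Max_ge) auto
  next
    case False
    then show ?thesis using decay[OF that] R[of "\<bar>of_int l\<bar>"] half by linarith
  qed
  ultimately show ?thesis using that[of K \<beta> \<rho>] K(1) \<beta>(1) decay by auto
qed

lemma summable_on_inverse_square_int: "(\<lambda>l. 1 / (real_of_int l)\<^sup>2) summable_on {l. l \<noteq> 0}"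
proof -
  let ?f = "\<lambda>l. 1 / (real_of_int l)\<^sup>2"
  have "summable (\<lambda>n. 1 / (real n)\<^sup>2)"
    using inverse_power_summable[of 2, where 'a=real] by (simp add: inverse_eq_divide)
  then have nat: "(\<lambda>n. 1 / (real n)\<^sup>2) summable_on UNIV"
    by (subst summable_on_UNIV_nonneg_real_iff) auto
  have "?f summable_on int ` UNIV" "?f summable_on (\<lambda>n. - int n) ` UNIV"
    using nat by (subst summable_on_reindex; simp add: inj_on_def o_def)+
  then have "?f summable_on (range int \<union> range (\<lambda>n. - int n))"
    by (rule summable_on_union)
  moreover have "{l. l \<noteq> 0} \<subseteq> range int \<union> range (\<lambda>n. - int n)"
  proof
    show "l \<in> range int \<union> range (\<lambda>n. - int n)" for l :: int
      by (cases l rule: int_cases2) auto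
  qed
  ultimately show ?thesis
    by (rule summable_on_subset_banach)
qed

text \<open>
  The number \<open>N\<close> of factors spent on decay is chosen with \<open>N \<beta> \<ge> 2\<close>, so that they contribute
  \<open>K ^ N / l\<^sup>2\<close>. Every other factor contributes \<open>\<rho>\<close>, and the resulting bound does not depend on \<open>p\<close>.
\<close>
lemma mellin_transform_condition_of_bounds:
  fixes I :: "'i set"
  assumes K: "0 \<le> K" "0 < \<beta>" "0 < \<rho>" "\<rho> < 1"
    and decay: "\<And>j l. j \<in> I \<Longrightarrow> l \<noteq> 0 \<Longrightarrow> norm (mellin_coeff B (f j) l) \<le> K * \<bar>of_int l\<bar> powr (-\<beta>)"
    and gap: "\<And>j l. j \<in> I \<Longrightarrow> l \<noteq> 0 \<Longrightarrow> norm (mellin_coeff B (f j) l) \<le> \<rho>"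
  shows "mellin_transform_condition B I f"
proof -
  define c where "c n p l = (\<Prod>m=1..n. mellin_coeff B (f (p m)) l)" for n :: nat and p :: "nat \<Rightarrow> 'i" and l
  define N where "N = nat \<lceil>2 / \<beta>\<rceil>"
  have N: "2 \<le> real N * \<beta>"
  proof -
    have "2 / \<beta> \<le> real N" unfolding N_def by linarith
    then show ?thesis using K by (simp add: field_simps)
  qed
  define s where "s = (\<lambda>l. 1 / (real_of_int l)\<^sup>2)"
  have s: "s summable_on {l. l \<noteq> 0}" unfolding s_def by (rule summable_on_inverse_square_int)
  define b where "b n l = \<rho> ^ (n - N) * K ^ N * s l" for n l
  have bound: "norm (c n p l) \<le> b n l"
    if n: "N \<le> n" and p: "p \<in> {1..} \<rightarrow>\<^sub>E I" and l: "l \<noteq> 0" for n p l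
  proof -
    have pI: "p m \<in> I" if "m \<ge> 1" for m using p that by (auto simp: PiE_iff)
    have "{1..n} = {1..N} \<union> {N+1..n}" using n by auto
    then have "norm (c n p l) = (\<Prod>m\<in>{1..N} \<union> {N+1..n}. norm (mellin_coeff B (f (p m)) l))"
      by (simp add: c_def prod_norm)
    also have "\<dots> = (\<Prod>m\<in>{1..N}. norm (mellin_coeff B (f (p m)) l)) *
        (\<Prod>m\<in>{N+1..n}. norm (mellin_coeff B (f (p m)) l))"
      by (rule prod.union_disjoint) auto
    also have "\<dots> \<le> (\<Prod>m\<in>{1..N}. K * \<bar>of_int l\<bar> powr (-\<beta>)) * (\<Prod>m\<in>{N+1..n}. \<rho>)"
      using K l pI by (intro mult_mono prod_mono conjI decay gap prod_nonneg) auto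
    also have "\<dots> = \<rho> ^ (n - N) * K ^ N * \<bar>of_int l\<bar> powr (-(real N * \<beta>))"
      using l by (simp add: power_mult_distrib powr_power mult_ac)
    also have "\<dots> \<le> \<rho> ^ (n - N) * K ^ N * \<bar>of_int l\<bar> powr (- 2)"
      using K N l by (intro mult_left_mono powr_mono) auto
    also have "\<dots> = b n l"
      using l by (simp add: b_def s_def powr_minus_divide powr_numeral)
    finally show ?thesis .
  qed
  have bs: "b n summable_on {l. l \<noteq> 0}" for n
    unfolding b_def by (intro summable_on_cmult_right s)
  have cs: "c n p summable_on {l. l \<noteq> 0}" if "N \<le> n" "p \<in> {1..} \<rightarrow>\<^sub>E I" for n p
    by (rule abs_summable_summable, rule Infinite_Sum.abs_summable_on_comparison_test'[OF bs[of n]])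
       (use bound that in auto)
  have norm_sum: "norm (\<Sum>\<^sub>\<infinity>l | l \<noteq> 0. c n p l) \<le> \<rho> ^ (n - N) * (K ^ N * infsum s {l. l \<noteq> 0})"
    if "N \<le> n" "p \<in> {1..} \<rightarrow>\<^sub>E I" for n p
  proof -
    have "norm (\<Sum>\<^sub>\<infinity>l | l \<noteq> 0. c n p l) \<le> infsum (b n) {l. l \<noteq> 0}"
      by (rule norm_infsum_le[OF has_sum_infsum[OF cs] has_sum_infsum[OF bs]])
         (use bound that in auto)
    also have "\<dots> = \<rho> ^ (n - N) * (K ^ N * infsum s {l. l \<noteq> 0})"
      unfolding b_def by (simp add: infsum_cmult_right' mult.assoc)
    finally show ?thesis .
  qed
  have "(\<lambda>n. \<rho> ^ (n - N) * (K ^ N * infsum s {l. l \<noteq> 0})) \<longlonglongrightarrow> 0 * (K ^ N * infsum s {l. l \<noteq> 0})"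
  proof (intro tendsto_mult tendsto_const)
    have "(\<lambda>n. \<rho> ^ n) \<longlonglongrightarrow> 0" using K by (intro LIMSEQ_realpow_zero) auto
    then have "(\<lambda>n. \<rho> ^ (n + N - N)) \<longlonglongrightarrow> 0" by simp
    then show "(\<lambda>n. \<rho> ^ (n - N)) \<longlonglongrightarrow> 0" by (rule LIMSEQ_offset)
  qed
  then have lim: "(\<lambda>n. \<rho> ^ (n - N) * (K ^ N * infsum s {l. l \<noteq> 0})) \<longlonglongrightarrow> 0" by simp
  have "uniform_limit ({1..} \<rightarrow>\<^sub>E I) (\<lambda>n p. \<Sum>\<^sub>\<infinity>l | l \<noteq> 0. c n p l) (\<lambda>p. 0) sequentially"
  proof (rule uniform_limitI)
    fix e :: real assume "0 < e"
    from order_tendstoD(2)[OF lim this] eventually_ge_at_top[of N]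
    show "\<forall>\<^sub>F n in sequentially. \<forall>p\<in>{1..} \<rightarrow>\<^sub>E I. dist (\<Sum>\<^sub>\<infinity>l | l \<noteq> 0. c n p l) 0 < e"
    proof eventually_elim
      case (elim n)
      then show ?case using le_less_trans[OF norm_sum elim(1)] by (simp add: dist_norm)
    qed
  qed
  moreover have "\<forall>\<^sub>F n in sequentially. \<forall>p\<in>{1..} \<rightarrow>\<^sub>E I. c n p summable_on {l. l \<noteq> 0}"
    using eventually_ge_at_top[of N] by eventually_elim (use cs in auto)
  ultimately show ?thesis
    unfolding mellin_transform_condition_def Let_def c_def by blast
qed

section \<open>A uniform Weyl criterion\<close>

text \<open>
  Generating these functions from monomials by addition matches how they are used: integrals are
  compared monomial by monomial, and only closure under multiplication takes an argument.
\<close>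
inductive trigonometric_polynomial :: "(real \<Rightarrow> complex) \<Rightarrow> bool" where
  monomial: "trigonometric_polynomial (\<lambda>u. c * cis (2 * pi * of_int l * u))"
| add: "trigonometric_polynomial S \<Longrightarrow> trigonometric_polynomial T \<Longrightarrow>
          trigonometric_polynomial (\<lambda>u. S u + T u)"

lemma trigonometric_polynomial_monomial_mult:
  assumes "trigonometric_polynomial T"
  shows "trigonometric_polynomial (\<lambda>u. c * cis (2 * pi * of_int l * u) * T u)"
  using assms
proof induction
  case (monomial d k)
  have "(\<lambda>u. c * cis (2 * pi * of_int l * u) * (d * cis (2 * pi * of_int k * u))) =
        (\<lambda>u. (c * d) * cis (2 * pi * of_int (l + k) * u))"
    by (rule ext) (simp add: ring_distribs flip: cis_mult)
  then show ?case by (metis trigonometric_polynomial.monomial)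
next
  case (add S T)
  then show ?case using trigonometric_polynomial.add by (fastforce simp: ring_distribs)
qed

lemma trigonometric_polynomial_mult:
  assumes "trigonometric_polynomial S" "trigonometric_polynomial T"
  shows "trigonometric_polynomial (\<lambda>u. S u * T u)"
  using assms(1)
proof induction
  case (monomial c l)
  then show ?case using trigonometric_polynomial_monomial_mult[OF assms(2)] by simp
next
  case (add S S')
  then show ?case using trigonometric_polynomial.add by (fastforce simp: ring_distribs)
qed

text \<open>
  Polynomials in the real and imaginary part of a point of the unit circle are trigonometric
  polynomials, because both parts are combinations of \<open>cis\<close> and its conjugate. So
  the Stone--Weierstrass theorem for real polynomial functions on the plane applies to them.
\<close>
lemma trigonometric_polynomial_real_polynomial_cis:
  fixes P :: "complex \<Rightarrow> real"
  assumes "real_polynomial_function P"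
  shows "trigonometric_polynomial (\<lambda>u. complex_of_real (P (cis (2 * pi * u))))"
  using assms
proof induction
  case (linear f)
  interpret bounded_linear f by fact
  have f: "f z = Re z * f 1 + Im z * f \<i>" for z
  proof -
    have "f z = f (Re z *\<^sub>R 1 + Im z *\<^sub>R \<i>)" by (rule arg_cong[where f=f]) (simp add: complex_eq_iff)
    then show ?thesis by (simp add: add scaleR)
  qed
  define a where "a = (f 1 - \<i> * f \<i>) / 2"
  define b where "b = (f 1 + \<i> * f \<i>) / 2"
  have "(\<lambda>u. complex_of_real (f (cis (2 * pi * u)))) =
     (\<lambda>u. a * cis (2 * pi * of_int 1 * u) + b * cis (2 * pi * of_int (-1) * u))"
    by (rule ext) (simp add: f[of "cis _"] a_def b_def complex_eq_iff field_simps)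
  then show ?case by (metis trigonometric_polynomial.intros)
next
  case (const c)
  show ?case using trigonometric_polynomial.monomial[of c 0] by simp
next
  case (add f g)
  then show ?case using trigonometric_polynomial.add by fastforce
next
  case (mult f g)
  then show ?case using trigonometric_polynomial_mult by fastforce
qed

lemma cis_borel_measurable [measurable]: "cis \<in> borel_measurable borel"
  by (intro borel_measurable_continuous_onI continuous_intros)

lemma integral_cis_unit_interval:
  "(LINT u:{0..1}|lborel. cis (2 * pi * of_int l * u)) = (if l = 0 then 1 else 0)"
proof (cases "l = 0")
  case True
  then show ?thesis by (simp add: set_lebesgue_integral_def)
next
  case False
  let ?k = "2 * pi * of_int l"
  have k: "?k \<noteq> 0" using False by simp
  define F where "F u = Complex (sin (?k * u) / ?k) (- cos (?k * u) / ?k)" for u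
  have "(LINT u:{0..1}|lborel. cis (?k * u)) = F 1 - F 0"
    unfolding set_lebesgue_integral_def
  proof (rule integral_FTC_Icc)
    show "(F has_vector_derivative cis (?k * u)) (at u within {0..1})" for u
      unfolding has_vector_derivative_complex_iff F_def using k
      by (auto intro!: derivative_eq_intros)
  qed (auto intro!: continuous_intros)
  also have "F 1 = F 0"
    by (simp add: F_def sin_int_2pin cos_int_2pin)
  finally show ?thesis using False by simp
qed

lemma trigonometric_polynomial_continuous:
  "trigonometric_polynomial T \<Longrightarrow> continuous_on A T"
  by (induction rule: trigonometric_polynomial.induct) (auto intro!: continuous_intros)

lemma trigonometric_polynomial_integrable:
  assumes "trigonometric_polynomial T" "finite_measure \<nu>" "sets \<nu> = sets borel"
  shows "integrable \<nu> T"
proof -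
  interpret finite_measure \<nu> by fact
  note [measurable_cong] = assms(3)
  show ?thesis using assms(1)
  proof induction
    case (monomial c l)
    show ?case
      by (intro integrable_mult_right integrable_const_bound[where B=1]) auto
  qed auto
qed

text \<open>
  Here and in the two results built on it, the frequencies \<open>L\<close> and the threshold \<open>\<delta>\<close> are chosen before the measure
  \<open>\<nu>\<close>. This order of quantifiers is what makes the convergence uniform over all
  sequences \<open>p\<close> later on. For a trigonometric polynomial, \<open>L\<close> consists of the nonzero frequencies that occur
  in it; the constant term has the same integral against every probability measure.
\<close>
lemma trigonometric_polynomial_integral_near:
  assumes "trigonometric_polynomial T" "0 < \<epsilon>"
  shows "\<exists>L \<delta>. finite L \<and> 0 \<notin> L \<and> 0 < \<delta> \<and> (\<forall>\<nu>. real_distribution \<nu> \<longrightarrow>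
      (\<forall>l\<in>L. norm (char \<nu> (2 * pi * of_int l)) < \<delta>) \<longrightarrow>
      norm ((LINT u|\<nu>. T u) - (LINT u:{0..1}|lborel. T u)) < \<epsilon>)"
  using assms
proof (induction arbitrary: \<epsilon> rule: trigonometric_polynomial.induct)
  case (monomial c l)
  have eq: "(LINT u|\<nu>. c * cis (2 * pi * of_int l * u)) = c * char \<nu> (2 * pi * of_int l)" for \<nu>
    by (simp add: char_def cis_conv_exp mult_ac)
  have eq': "(LINT u:{0..1}|lborel. c * cis (2 * pi * of_int l * u)) = c * (if l = 0 then 1 else 0)"
    using integral_cis_unit_interval[of l] by simp
  show ?case
  proof (cases "l = 0")
    case True
    then show ?thesis unfolding eq eq' using monomial
      by (intro exI[of _ "{}"] exI[of _ 1]) (auto simp: real_distribution.char_zero)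
  next
    case False
    have "norm (c * z) < \<epsilon>" if "norm z < \<epsilon> / (norm c + 1)" for z
    proof -
      have "norm (c * z) \<le> (norm c + 1) * norm z" by (simp add: norm_mult mult_right_mono)
      also have "\<dots> < \<epsilon>" using that by (simp add: field_simps add_pos_nonneg)
      finally show ?thesis .
    qed
    then show ?thesis unfolding eq eq' using monomial False
      by (intro exI[of _ "{l}"] exI[of _ "\<epsilon> / (norm c + 1)"]) (auto simp: add_nonneg_pos)
  qed
next
  case (add S T)
  obtain L \<delta> where L: "finite L" "0 \<notin> L" "0 < \<delta>"
    and S: "\<And>\<nu>. real_distribution \<nu> \<Longrightarrow> \<forall>l\<in>L. norm (char \<nu> (2 * pi * of_int l)) < \<delta> \<Longrightarrow>
      norm ((LINT u|\<nu>. S u) - (LINT u:{0..1}|lborel. S u)) < \<epsilon> / 2"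
    using add.IH(1)[of "\<epsilon> / 2"] add.prems by auto
  obtain L' \<delta>' where L': "finite L'" "0 \<notin> L'" "0 < \<delta>'"
    and T: "\<And>\<nu>. real_distribution \<nu> \<Longrightarrow> \<forall>l\<in>L'. norm (char \<nu> (2 * pi * of_int l)) < \<delta>' \<Longrightarrow>
      norm ((LINT u|\<nu>. T u) - (LINT u:{0..1}|lborel. T u)) < \<epsilon> / 2"
    using add.IH(2)[of "\<epsilon> / 2"] add.prems by auto
  show ?case
  proof (intro exI[of _ "L \<union> L'"] exI[of _ "min \<delta> \<delta>'"] conjI allI impI)
    fix \<nu> assume \<nu>: "real_distribution \<nu>"
      "\<forall>l\<in>L \<union> L'. norm (char \<nu> (2 * pi * of_int l)) < min \<delta> \<delta>'"
    interpret real_distribution \<nu> by fact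
    have i: "integrable \<nu> S" "integrable \<nu> T"
      using add.hyps by (auto intro: trigonometric_polynomial_integrable finite_measure_axioms)
    have j: "set_integrable lborel {0..1} S" "set_integrable lborel {0..1} T"
      using add.hyps by (auto intro!: borel_integrable_atLeastAtMost' trigonometric_polynomial_continuous)
    have "(LINT u|\<nu>. S u + T u) - (LINT u:{0..1}|lborel. S u + T u) =
       ((LINT u|\<nu>. S u) - (LINT u:{0..1}|lborel. S u)) + ((LINT u|\<nu>. T u) - (LINT u:{0..1}|lborel. T u))"
      using i j by (simp add: set_integral_add)
    then show "norm ((LINT u|\<nu>. S u + T u) - (LINT u:{0..1}|lborel. S u + T u)) < \<epsilon>"
      using norm_triangle_lt[OF order.strict_trans2[OF add_strict_mono[OF S[OF \<nu>(1)] T[OF \<nu>(1)]]]] \<nu>(2)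
      by simp
  qed (use L L' in auto)
qed

text \<open>
  A function on the circle is approximated to within \<open>\<epsilon> / 3\<close>, which costs at most that much in the integral
  against \<open>\<nu>\<close> and in the one against the uniform measure.
\<close>
lemma continuous_circle_integral_near:
  fixes h :: "complex \<Rightarrow> real"
  assumes h: "continuous_on UNIV h" and "0 < \<epsilon>"
  shows "\<exists>L \<delta>. finite L \<and> 0 \<notin> L \<and> 0 < \<delta> \<and> (\<forall>\<nu>. real_distribution \<nu> \<longrightarrow>
      (\<forall>l\<in>L. norm (char \<nu> (2 * pi * of_int l)) < \<delta>) \<longrightarrow>
      \<bar>(LINT u|\<nu>. h (cis (2 * pi * u))) - (LINT u:{0..1}|lborel. h (cis (2 * pi * u)))\<bar> < \<epsilon>)"
proof -
  obtain P where P: "real_polynomial_function P" "\<And>z. z \<in> sphere 0 1 \<Longrightarrow> \<bar>h z - P z\<bar> < \<epsilon> / 3"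
    using Stone_Weierstrass_real_polynomial_function[of "sphere 0 1" h "\<epsilon> / 3"] assms
      continuous_on_subset[OF h] by (metis compact_sphere divide_pos_pos subset_UNIV zero_less_numeral)
  have near: "\<bar>h (cis t) - P (cis t)\<bar> \<le> \<epsilon> / 3" for t using P(2)[of "cis t"] by simp
  have contP: "continuous_on A P" for A using P(1) by (simp add: continuous_on_polymonial_function real_polynomial_function_eq)
  let ?h = "\<lambda>u. h (cis (2 * pi * u))" and ?P = "\<lambda>u. P (cis (2 * pi * u))"
  have conth: "continuous_on A ?h" for A
    by (rule continuous_on_compose2[OF h]) (auto intro!: continuous_intros)
  have contP': "continuous_on A ?P" for A
    by (rule continuous_on_compose2[OF contP[of UNIV]]) (auto intro!: continuous_intros)
  have trig: "trigonometric_polynomial (\<lambda>u. complex_of_real (?P u))"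
    using P(1) by (rule trigonometric_polynomial_real_polynomial_cis)
  obtain L \<delta> where L: "finite L" "0 \<notin> L" "0 < \<delta>"
    and T: "\<And>\<nu>. real_distribution \<nu> \<Longrightarrow> \<forall>l\<in>L. norm (char \<nu> (2 * pi * of_int l)) < \<delta> \<Longrightarrow>
      norm ((LINT u|\<nu>. complex_of_real (?P u)) - (LINT u:{0..1}|lborel. complex_of_real (?P u))) < \<epsilon> / 3"
    using trigonometric_polynomial_integral_near[OF trig, of "\<epsilon> / 3"] \<open>0 < \<epsilon>\<close> by auto
  have J: "\<bar>(LINT u:{0..1}|lborel. ?h u) - (LINT u:{0..1}|lborel. ?P u)\<bar> \<le> \<epsilon> / 3"
  proof -
    have i: "set_integrable lborel {0..1} ?h" "set_integrable lborel {0..1} ?P"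
      by (intro borel_integrable_atLeastAtMost' conth contP')+
    have "\<bar>LINT u:{0..1}|lborel. ?h u - ?P u\<bar> \<le> (LINT u:{0..1::real}|lborel. \<epsilon> / 3)"
      unfolding real_norm_def[symmetric] set_lebesgue_integral_def
    proof (rule Bochner_Integration.integral_norm_bound_integral)
      show "integrable lborel (\<lambda>x. indicator {0..1} x *\<^sub>R (?h x - ?P x))"
        using set_integral_diff(1)[OF i] by (simp add: set_integrable_def)
      show "integrable lborel (\<lambda>x. indicator {0..1::real} x *\<^sub>R (\<epsilon> / 3))"
        by (intro integrable_scaleR_left) auto
    qed (use near in \<open>auto simp: indicator_def\<close>)
    also have "\<dots> = \<epsilon> / 3" by (simp add: set_lebesgue_integral_def)
    finally show ?thesis using set_integral_diff(2)[OF i] by simp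
  qed
  show ?thesis
  proof (intro exI[of _ L] exI[of _ \<delta>] conjI allI impI)
    fix \<nu> assume \<nu>: "real_distribution \<nu>" "\<forall>l\<in>L. norm (char \<nu> (2 * pi * of_int l)) < \<delta>"
    interpret real_distribution \<nu> by fact
    have iP: "integrable \<nu> ?P"
      using integrable_Re[OF trigonometric_polynomial_integrable[OF trig finite_measure_axioms]] by simp
    have [measurable]: "?h \<in> borel_measurable borel" by (intro borel_measurable_continuous_onI conth)
    have d: "integrable \<nu> (\<lambda>u. ?h u - ?P u)"
      using near iP by (intro integrable_const_bound[where B="\<epsilon> / 3"]) auto
    then have ih: "integrable \<nu> ?h" using Bochner_Integration.integrable_add[OF d iP] by simp
    have "\<bar>LINT u|\<nu>. ?h u - ?P u\<bar> \<le> (LINT u|\<nu>. \<epsilon> / 3)"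
      unfolding real_norm_def[symmetric] by (rule Bochner_Integration.integral_norm_bound_integral) (use d near in auto)
    then have I: "\<bar>(LINT u|\<nu>. ?h u) - (LINT u|\<nu>. ?P u)\<bar> \<le> \<epsilon> / 3"
      using ih iP prob_space by simp
    have "(LINT u:{0..1}|lborel. complex_of_real (?P u)) = complex_of_real (LINT u:{0..1}|lborel. ?P u)"
      by (rule set_integral_complex_of_real)
    then have "norm (complex_of_real ((LINT u|\<nu>. ?P u) - (LINT u:{0..1}|lborel. ?P u))) < \<epsilon> / 3"
      using T[OF \<nu>] by simp
    then have "\<bar>(LINT u|\<nu>. ?P u) - (LINT u:{0..1}|lborel. ?P u)\<bar> < \<epsilon> / 3"
      unfolding norm_of_real .
    with I J show "\<bar>(LINT u|\<nu>. ?h u) - (LINT u:{0..1}|lborel. ?h u)\<bar> < \<epsilon>"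
      by linarith
  qed (use L in auto)
qed

lemma frac_borel_measurable [measurable]: "(frac :: real \<Rightarrow> real) \<in> borel_measurable borel"
  unfolding frac_def by measurable

lemma cis_2pi_frac: "cis (2 * pi * frac u) = cis (2 * pi * u)"
proof -
  have "2 * pi * u = 2 * pi * frac u + 2 * pi * of_int \<lfloor>u\<rfloor>" by (simp add: frac_def algebra_simps)
  then have "cis (2 * pi * u) = cis (2 * pi * frac u) * cis (2 * pi * of_int \<lfloor>u\<rfloor>)"
    by (metis cis_mult)
  then show ?thesis by simp
qed

lemma cis_2pi_eq_unit_interval:
  assumes "cis (2 * pi * u) = cis (2 * pi * v)" "0 < u" "u < 1" "0 \<le> v" "v \<le> 1"
  shows "u = v"
proof -
  have "cis (2 * pi * u - 2 * pi * v) = 1" using assms(1) by (simp flip: cis_divide)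
  then have "cos (2 * pi * u - 2 * pi * v) = 1" by (simp add: complex_eq_iff)
  then obtain k :: int where "2 * pi * u - 2 * pi * v = of_int k * (2 * pi)"
    unfolding cos_one_2pi_int by auto
  then have "2 * pi * (u - v) = 2 * pi * of_int k" by (simp add: algebra_simps)
  then have k: "u - v = of_int k" by simp
  then have "-1 < real_of_int k" "real_of_int k < 1" using assms by linarith+
  then have "k = 0" by linarith
  with k show ?thesis by simp
qed

text \<open>
  The indicator of the open arc is the increasing limit of the continuous functions
  \<open>h k z = min 1 (k * infdist z K)\<close>, where \<open>K\<close> is the closed complementary arc. By dominated
  convergence some \<open>h k\<close> has uniform integral above \<open>b - a - \<epsilon> / 2\<close>, and its integral against
  \<open>\<nu>\<close> is a lower bound for the measure of the arc. Defining \<open>h k\<close> on the plane rather than on an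
  interval makes periodicity and continuity automatic.
\<close>
lemma arc_measure_lower_bound:
  assumes ab: "0 \<le> a" "a \<le> b" "b \<le> 1" and "0 < \<epsilon>"
  shows "\<exists>L \<delta>. finite L \<and> 0 \<notin> L \<and> 0 < \<delta> \<and> (\<forall>\<nu>. real_distribution \<nu> \<longrightarrow>
      (\<forall>l\<in>L. norm (char \<nu> (2 * pi * of_int l)) < \<delta>) \<longrightarrow>
      measure \<nu> {u. frac u \<in> {a<..<b}} > b - a - \<epsilon>)"
proof -
  let ?e = "\<lambda>u. cis (2 * pi * u)"
  define K where "K = ?e ` ({0..a} \<union> {b..1})"
  \<comment> \<open>Even for \<open>a = 0\<close> and \<open>b = 1\<close> the set \<open>K\<close> contains the point 1; \<open>infdist\<close> to the empty set
    would be 0.\<close>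
  have K: "compact K" "K \<noteq> {}" unfolding K_def using ab
    by (auto intro!: compact_continuous_image continuous_intros compact_Un)
  define h where "h = (\<lambda>(k::nat) z. min 1 (real k * infdist z K))"
  have cont: "continuous_on A (h k)" for k A unfolding h_def by (auto intro!: continuous_intros)
  have h01: "0 \<le> h k z" "h k z \<le> 1" for k z by (auto simp: h_def infdist_nonneg)
  have hK: "h k (?e u) = 0" if "u \<in> {0..1}" "u \<notin> {a<..<b}" for k u
  proof -
    have "?e u \<in> K" using that by (auto simp: K_def)
    then show ?thesis by (simp add: h_def)
  qed
  have lim: "(\<lambda>k. h k (?e u)) \<longlonglongrightarrow> 1" if "u \<in> {a<..<b}" for u
  proof -
    have "?e u \<notin> K"
    proof
      assume "?e u \<in> K"
      then obtain v where v: "v \<in> {0..a} \<union> {b..1}" "?e u = ?e v" unfolding K_def by blast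
      then have "u = v" using that ab by (intro cis_2pi_eq_unit_interval) auto
      with v that show False by auto
    qed
    then have d: "infdist (?e u) K > 0"
      using K by (metis compact_imp_closed in_closed_iff_infdist_zero infdist_nonneg less_eq_real_def)
    have "\<forall>\<^sub>F k in sequentially. real k \<ge> 1 / infdist (?e u) K" 
      using filterlim_real_sequentially by (simp add: filterlim_at_top)
    then have "\<forall>\<^sub>F k in sequentially. h k (?e u) = 1"
      by eventually_elim (use d in \<open>simp add: h_def field_simps\<close>)
    then show ?thesis by (rule tendsto_eventually)
  qed
  have "(\<lambda>k. LINT u:{0..1}|lborel. h k (?e u)) \<longlonglongrightarrow> (LINT u|lborel. indicator {a<..<b} u)"
    unfolding set_lebesgue_integral_def
  proof (rule integral_dominated_convergence[where w="indicator {0..1}"])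
    show "(\<lambda>u. indicator {0..1} u *\<^sub>R h k (?e u)) \<in> borel_measurable lborel" for k
    proof -
      have [measurable]: "h k \<in> borel_measurable borel" by (intro borel_measurable_continuous_onI cont)
      show ?thesis by measurable
    qed
    show "AE u in lborel. (\<lambda>k. indicator {0..1} u *\<^sub>R h k (?e u)) \<longlonglongrightarrow> indicator {a<..<b} u"
    proof (rule AE_I2)
      fix u :: real
      show "(\<lambda>k. indicator {0..1} u *\<^sub>R h k (?e u)) \<longlonglongrightarrow> indicator {a<..<b} u"
      proof (cases "u \<in> {a<..<b}")
        case True
        then show ?thesis using lim[OF True] ab by simp
      next
        case False
        then show ?thesis using hK[of u] by (cases "u \<in> {0..1}") auto
      qed
    qed
  qed (use h01 in \<open>auto simp: indicator_def\<close>)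
  then have "(\<lambda>k. LINT u:{0..1}|lborel. h k (?e u)) \<longlonglongrightarrow> b - a" using ab by simp
  then have "\<forall>\<^sub>F k in sequentially. (LINT u:{0..1}|lborel. h k (?e u)) > b - a - \<epsilon> / 2"
    by (rule order_tendstoD) (use \<open>0 < \<epsilon>\<close> in simp)
  then obtain k where k: "(LINT u:{0..1}|lborel. h k (?e u)) > b - a - \<epsilon> / 2"
    using eventually_happens'[OF sequentially_bot] by blast
  obtain L \<delta> where L: "finite L" "0 \<notin> L" "0 < \<delta>"
    and T: "\<And>\<nu>. real_distribution \<nu> \<Longrightarrow> \<forall>l\<in>L. norm (char \<nu> (2 * pi * of_int l)) < \<delta> \<Longrightarrow>
      \<bar>(LINT u|\<nu>. h k (?e u)) - (LINT u:{0..1}|lborel. h k (?e u))\<bar> < \<epsilon> / 2"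
    using continuous_circle_integral_near[OF cont, of "\<epsilon> / 2" k] \<open>0 < \<epsilon>\<close> by auto
  show ?thesis
  proof (intro exI[of _ L] exI[of _ \<delta>] conjI allI impI)
    fix \<nu> assume \<nu>: "real_distribution \<nu>" "\<forall>l\<in>L. norm (char \<nu> (2 * pi * of_int l)) < \<delta>"
    interpret real_distribution \<nu> by fact
    have [measurable]: "h k \<in> borel_measurable borel" by (intro borel_measurable_continuous_onI cont)
    have S: "{u. frac u \<in> {a<..<b}} \<in> events" by measurable
    have "(LINT u|\<nu>. h k (?e u)) \<le> (LINT u|\<nu>. indicator {u. frac u \<in> {a<..<b}} u)"
    proof (rule integral_mono)
      show "integrable \<nu> (\<lambda>u. h k (?e u))"
        by (rule integrable_const_bound[where B=1]) (use h01 in auto)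
      show "integrable \<nu> (indicator {u. frac u \<in> {a<..<b}} :: real \<Rightarrow> real)"
        using S by (intro integrable_real_indicator) (auto simp: emeasure_eq_measure)
      fix u :: real
      have "frac u \<in> {0..1}" by (simp add: frac_ge_0 less_imp_le frac_lt_1)
      then show "h k (?e u) \<le> indicator {u. frac u \<in> {a<..<b}} u"
        using hK[of "frac u" k] h01[of k "?e u"] by (auto simp: cis_2pi_frac indicator_def)
    qed
    also have "\<dots> = measure \<nu> {u. frac u \<in> {a<..<b}}" using S by simp
    finally show "measure \<nu> {u. frac u \<in> {a<..<b}} > b - a - \<epsilon>"
      using T[OF \<nu>] k by linarith
  qed (use L in auto)
qed

section \<open>Significands of independent products\<close>

lemma significand_eq_powr_frac:
  assumes B: "B > 1" and x: "x > 0"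
  shows "significand B x = B powr frac (log B x)"
  unfolding significand_def
proof (rule the_equality)
  have powi: "B powi j = B powr of_int j" for j using B by (simp add: powr_real_of_int')
  have "x = B powr (frac (log B x) + of_int \<lfloor>log B x\<rfloor>)" using B x by (simp add: frac_def)
  then have "x = B powr frac (log B x) * B powi \<lfloor>log B x\<rfloor>" by (simp add: powr_add powi)
  moreover have "1 \<le> B powr frac (log B x)" using B by (simp add: ge_one_powr_ge_zero)
  moreover have "B powr frac (log B x) < B powr 1" using B by (intro powr_less_mono frac_lt_1)
  ultimately show "B powr frac (log B x) \<in> {1..<B} \<and> (\<exists>j::int. x = B powr frac (log B x) * B powi j)"
    using B by auto
  fix s assume s: "s \<in> {1..<B} \<and> (\<exists>j::int. x = s * B powi j)"
  then obtain j :: int where j: "x = s * B powr of_int j" using powi by auto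
  then have "log B x = log B s + of_int j" using B s by (simp add: log_mult)
  moreover have "0 \<le> log B s" "log B s < 1" using B s by auto
  ultimately have "frac (log B x) = log B s" by (simp add: frac_unique_iff)
  then show "s = B powr frac (log B x)" using B s by simp
qed

lemma significand_nonpos:
  assumes "B > 1" "x \<le> 0"
  shows "significand B x = (THE s::real. False)"
proof -
  have "\<not> (s \<in> {1..<B} \<and> (\<exists>j::int. x = s * B powi j))" for s
  proof clarify
    fix j assume "s \<in> {1..<B}" "x = s * B powi j"
    then have "x > 0" using assms(1) by simp
    then show False using assms(2) by simp
  qed
  then have "(\<lambda>s. s \<in> {1..<B} \<and> (\<exists>j::int. x = s * B powi j)) = (\<lambda>s. False)" by blast
  then show ?thesis unfolding significand_def by (rule arg_cong)
qed

text \<open>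
  On nonpositive arguments the significand is one fixed number, so it is
  measurable on the whole line. This matters because \<open>measure\<close> is 0 on sets that are not
  measurable.
\<close>
lemma significand_borel_measurable:
  assumes "B > 1"
  shows "significand B \<in> borel_measurable borel"
proof -
  have "significand B = (\<lambda>x. if x > 0 then B powr frac (log B x) else (THE s. False))"
    using assms by (intro ext) (simp add: significand_eq_powr_frac significand_nonpos)
  then show ?thesis by simp
qed

text \<open>
  The sign of the frequency changes because characteristic functions use \<open>cis (t x)\<close> whereas the
  Mellin coefficients use \<open>cis (- \<tau> ln x)\<close>. It is harmless, as the bounds hold at all nonzero
  frequencies.
\<close>
lemma char_log_eq_mellin_coeff:
  assumes "has_density_on_nonneg D f" "B > 1"
  shows "char (distr D borel (log B)) (2 * pi * of_int l) = mellin_coeff B f (- l)"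
proof -
  note g = positive_part_of_density[OF assms(1)]
  have [measurable]: "(\<lambda>x. indicator {0<..} x * f x) \<in> borel_measurable lborel" using g(1) by auto
  have sets: "sets D = sets borel" by (subst g(4)) simp
  note [measurable_cong] = sets
  have "char (distr D borel (log B)) (2 * pi * of_int l) = (LINT x|D. cis (2 * pi * of_int l * log B x))"
    unfolding char_def by (subst integral_distr) (auto simp: cis_conv_exp)
  also have "\<dots> = (LINT x|lborel. (indicator {0<..} x * f x) *\<^sub>R cis (2 * pi * of_int l * log B x))"
    by (subst g(4), subst integral_density) (use g in auto)
  also have "\<dots> = mellin_coeff B f (- l)"
    unfolding mellin_coeff_eq by (simp add: log_def)
  finally show ?thesis .
qed

lemma char_log_product:
  assumes ind: "independent_sequence_with_laws M X D"
    and dens: "\<And>m. m \<ge> 1 \<Longrightarrow> has_density_on_nonneg (D m) (f m)" and B: "B > 1"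
  shows "char (distr M borel (\<lambda>\<omega>. \<Sum>m=1..n. log B (X m \<omega>))) (2 * pi * of_int l) =
     (\<Prod>m=1..n. mellin_coeff B (f m) (- l))"
proof -
  interpret prob_space M using ind by (simp add: independent_sequence_with_laws_def)
  have X: "indep_vars (\<lambda>m. borel) X {1..}" "\<And>m. m \<ge> 1 \<Longrightarrow> distr M borel (X m) = D m"
    using ind by (auto simp: independent_sequence_with_laws_def)
  have "indep_vars (\<lambda>m. borel) (\<lambda>m \<omega>. log B (X m \<omega>)) {1..n}"
    by (rule indep_vars_compose2[OF indep_vars_subset[OF X(1)]]) auto
  then have "char (distr M borel (\<lambda>\<omega>. \<Sum>m=1..n. log B (X m \<omega>))) (2 * pi * of_int l) =
     (\<Prod>m=1..n. char (distr M borel (\<lambda>\<omega>. log B (X m \<omega>))) (2 * pi * of_int l))"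
    by (rule char_distr_sum)
  also have "\<dots> = (\<Prod>m=1..n. mellin_coeff B (f m) (- l))"
  proof (rule prod.cong)
    fix m assume "m \<in> {1..n}"
    then have m: "m \<ge> 1" by simp
    have [measurable]: "X m \<in> borel_measurable M" using X(1) m by (auto simp: indep_vars_def)
    have "distr M borel (\<lambda>\<omega>. log B (X m \<omega>)) = distr (D m) borel (log B)"
      unfolding X(2)[OF m, symmetric] by (subst distr_distr) (auto simp: o_def)
    then show "char (distr M borel (\<lambda>\<omega>. log B (X m \<omega>))) (2 * pi * of_int l) = mellin_coeff B (f m) (- l)"
      using char_log_eq_mellin_coeff[OF dens[OF m] B] by simp
  qed simp
  finally show ?thesis .
qed

lemma AE_positive_of_density:
  assumes "has_density_on_nonneg D f"
  shows "AE x in D. x > 0"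
proof -
  note g = positive_part_of_density[OF assms]
  have [measurable]: "(\<lambda>x. indicator {0<..} x * f x) \<in> borel_measurable lborel" using g(1) by auto
  have "AE x in density lborel (\<lambda>x. ennreal (indicator {0<..} x * f x)). x > 0"
    by (subst AE_density) (measurable, auto simp: indicator_def)
  then show ?thesis by (subst g(4))
qed

text \<open>
  The event \<open>significand B Y \<le> s\<close> contains the open arc from 0 to \<open>t = log B s\<close> and avoids the
  open arc from \<open>t\<close> to 1. Lower bounds for the measures of these two arcs, whose lengths add up to 1,
  therefore bound its probability from below and from above.
\<close>
lemma significand_cdf_near:
  assumes s: "s \<in> {1..<B}" and B: "B > 1" and "0 < \<epsilon>"
  shows "\<exists>L \<delta>. finite L \<and> 0 \<notin> L \<and> 0 < \<delta> \<and>
    (\<forall>(M :: 'a measure) Y. prob_space M \<longrightarrow> Y \<in> borel_measurable M \<longrightarrow> (AE \<omega> in M. Y \<omega> > 0) \<longrightarrow>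
      (\<forall>l\<in>L. norm (char (distr M borel (\<lambda>\<omega>. log B (Y \<omega>))) (2 * pi * of_int l)) < \<delta>) \<longrightarrow>
      \<bar>measure M {\<omega> \<in> space M. significand B (Y \<omega>) \<le> s} - log B s\<bar> < \<epsilon>)"
proof -
  define t where "t = log B s"
  have t: "0 \<le> t" "t \<le> 1" "s = B powr t" using s B by (auto simp: t_def)
  obtain L \<delta> where L: "finite L" "0 \<notin> L" "0 < \<delta>" and below: "\<And>\<nu>. real_distribution \<nu> \<Longrightarrow>
      \<forall>l\<in>L. norm (char \<nu> (2 * pi * of_int l)) < \<delta> \<Longrightarrow> measure \<nu> {u. frac u \<in> {0<..<t}} > t - 0 - \<epsilon>"
    using arc_measure_lower_bound[of 0 t \<epsilon>] t \<open>0 < \<epsilon>\<close> by auto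
  obtain L' \<delta>' where L': "finite L'" "0 \<notin> L'" "0 < \<delta>'" and above: "\<And>\<nu>. real_distribution \<nu> \<Longrightarrow>
      \<forall>l\<in>L'. norm (char \<nu> (2 * pi * of_int l)) < \<delta>' \<Longrightarrow> measure \<nu> {u. frac u \<in> {t<..<1}} > 1 - t - \<epsilon>"
    using arc_measure_lower_bound[of t 1 \<epsilon>] t \<open>0 < \<epsilon>\<close> by auto
  show ?thesis
  proof (intro exI[of _ "L \<union> L'"] exI[of _ "min \<delta> \<delta>'"] conjI allI impI)
    fix M :: "'a measure" and Y
    assume "prob_space M" and [measurable]: "Y \<in> borel_measurable M"
      and pos: "AE \<omega> in M. Y \<omega> > 0"
      and small: "\<forall>l\<in>L \<union> L'. norm (char (distr M borel (\<lambda>\<omega>. log B (Y \<omega>))) (2 * pi * of_int l)) < min \<delta> \<delta>'"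
    interpret prob_space M by fact
    let ?U = "\<lambda>\<omega>. log B (Y \<omega>)"
    let ?\<nu> = "distr M borel ?U"
    have rd: "real_distribution ?\<nu>" by (rule real_distribution_distr) simp
    note [measurable] = significand_borel_measurable[OF B]
    have meas: "measure ?\<nu> {u. frac u \<in> {a<..<b}} = prob {\<omega> \<in> space M. frac (?U \<omega>) \<in> {a<..<b}}" for a b
      by (subst measure_distr) (auto intro!: arg_cong[where f="measure M"])
    let ?E = "{\<omega> \<in> space M. significand B (Y \<omega>) \<le> s}"
    have E: "?E \<in> events" by measurable
    have key: "significand B (Y \<omega>) \<le> s \<longleftrightarrow> frac (?U \<omega>) \<le> t" if "Y \<omega> > 0" for \<omega>
      using that B by (simp add: significand_eq_powr_frac t(3))
    have "prob {\<omega> \<in> space M. frac (?U \<omega>) \<in> {0<..<t}} \<le> prob ?E"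
      by (rule finite_measure_mono_AE[OF _ E]) (use pos in \<open>eventually_elim, use key in auto\<close>)
    moreover have "prob {\<omega> \<in> space M. frac (?U \<omega>) \<in> {t<..<1}} \<le> prob (space M - ?E)"
    proof (rule finite_measure_mono_AE)
      show "AE \<omega> in M. \<omega> \<in> {\<omega> \<in> space M. frac (?U \<omega>) \<in> {t<..<1}} \<longrightarrow> \<omega> \<in> space M - ?E"
        using pos by eventually_elim (use key in auto)
    qed (use E in auto)
    moreover have "prob (space M - ?E) = 1 - prob ?E" using E by (rule prob_compl)
    moreover have "t - 0 - \<epsilon> < prob {\<omega> \<in> space M. frac (?U \<omega>) \<in> {0<..<t}}"
      using below[OF rd] small unfolding meas by simp
    moreover have "1 - t - \<epsilon> < prob {\<omega> \<in> space M. frac (?U \<omega>) \<in> {t<..<1}}"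
      using above[OF rd] small unfolding meas by simp
    ultimately show "\<bar>prob ?E - log B s\<bar> < \<epsilon>" unfolding t_def[symmetric] by linarith
  qed (use L L' in auto)
qed

text \<open>
  All Fourier coefficients of the logarithm of the product at nonzero frequencies are at most
  \<open>\<rho> ^ n\<close>, so from some \<open>n\<close> on, chosen independently of \<open>p\<close>, they fall below the
  threshold of the Weyl criterion.
\<close>
lemma uniformly_benford_of_spectral_gap:
  fixes M :: "(nat \<Rightarrow> 'i) \<Rightarrow> 'a measure"
  assumes B: "B > 1" and \<rho>: "0 < \<rho>" "\<rho> < 1"
    and dens: "\<And>j. j \<in> I \<Longrightarrow> has_density_on_nonneg (D j) (f j)"
    and gap: "\<And>j l. j \<in> I \<Longrightarrow> l \<noteq> 0 \<Longrightarrow> norm (mellin_coeff B (f j) l) \<le> \<rho>"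
    and ind: "\<And>p. p \<in> {1..} \<rightarrow>\<^sub>E I \<Longrightarrow> independent_sequence_with_laws (M p) (X p) (\<lambda>m. D (p m))"
    and s: "s \<in> {1..<B}" and "0 < \<epsilon>"
  shows "\<forall>\<^sub>F n in sequentially. \<forall>p \<in> {1..} \<rightarrow>\<^sub>E I.
    \<bar>measure (M p) {\<omega> \<in> space (M p). significand B (\<Prod>m=1..n. X p m \<omega>) \<le> s} - log B s\<bar> < \<epsilon>"
proof -
  obtain L \<delta> where L: "finite L" "0 \<notin> L" "0 < \<delta>"
    and near: "\<And>(M :: 'a measure) Y. prob_space M \<Longrightarrow> Y \<in> borel_measurable M \<Longrightarrow> AE \<omega> in M. Y \<omega> > 0 \<Longrightarrow>
      \<forall>l\<in>L. norm (char (distr M borel (\<lambda>\<omega>. log B (Y \<omega>))) (2 * pi * of_int l)) < \<delta> \<Longrightarrow>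
      \<bar>measure M {\<omega> \<in> space M. significand B (Y \<omega>) \<le> s} - log B s\<bar> < \<epsilon>"
    using significand_cdf_near[OF s B \<open>0 < \<epsilon>\<close>, where 'a='a] by blast
  have "(\<lambda>n. \<rho> ^ n) \<longlonglongrightarrow> 0" using \<rho> by (intro LIMSEQ_realpow_zero) auto
  from order_tendstoD(2)[OF this L(3)] show ?thesis
  proof eventually_elim
    case (elim n)
    show ?case
    proof
      fix p :: "nat \<Rightarrow> 'i" assume p: "p \<in> {1..} \<rightarrow>\<^sub>E I"
      then have pI: "p m \<in> I" if "m \<ge> 1" for m using that by (auto simp: PiE_iff)
      note indp = ind[OF p]
      interpret prob_space "M p" using indp by (simp add: independent_sequence_with_laws_def)
      have X: "X p m \<in> borel_measurable (M p)" "distr (M p) borel (X p m) = D (p m)" if "m \<ge> 1" for m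
        using indp that by (auto simp: independent_sequence_with_laws_def indep_vars_def)
      have Xpos: "AE \<omega> in M p. X p m \<omega> > 0" if "m \<ge> 1" for m
      proof -
        have "AE x in distr (M p) borel (X p m). x > 0"
          unfolding X(2)[OF that] by (rule AE_positive_of_density[OF dens[OF pI[OF that]]])
        then show ?thesis by (subst (asm) AE_distr_iff) (use X(1)[OF that] in auto)
      qed
      have AEpos: "AE \<omega> in M p. \<forall>m\<in>{1..n}. X p m \<omega> > 0"
        by (rule AE_finite_allI) (use Xpos in auto)
      have Xm [measurable]: "X p m \<in> borel_measurable (M p)" if "m \<in> {1..n}" for m using X that by auto
      let ?Y = "\<lambda>\<omega>. \<Prod>m=1..n. X p m \<omega>"
      have Y[measurable]: "?Y \<in> borel_measurable (M p)" by (intro borel_measurable_prod Xm)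
      have log_Y: "log B (?Y \<omega>) = (\<Sum>m=1..n. log B (X p m \<omega>))" if "\<forall>m\<in>{1..n}. X p m \<omega> > 0" for \<omega>
        using that ln_prod[of "{1..n}" "\<lambda>m. X p m \<omega>"]
        by (force simp: log_def sum_divide_distrib)
      have "AE \<omega> in M p. log B (?Y \<omega>) = (\<Sum>m=1..n. log B (X p m \<omega>))"
        using AEpos by eventually_elim (rule log_Y)
      then have dist: "distr (M p) borel (\<lambda>\<omega>. log B (?Y \<omega>)) = distr (M p) borel (\<lambda>\<omega>. \<Sum>m=1..n. log B (X p m \<omega>))"
        by (intro distr_cong_AE) (auto intro!: borel_measurable_sum measurable_compose[OF Xm])
      show "\<bar>prob {\<omega> \<in> space (M p). significand B (?Y \<omega>) \<le> s} - log B s\<bar> < \<epsilon>"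
      proof (rule near[OF prob_space_axioms Y])
        show "AE \<omega> in M p. ?Y \<omega> > 0" using AEpos by eventually_elim (auto intro: prod_pos)
        show "\<forall>l\<in>L. norm (char (distr (M p) borel (\<lambda>\<omega>. log B (?Y \<omega>))) (2 * pi * of_int l)) < \<delta>"
        proof
          fix l assume "l \<in> L"
          then have l: "- l \<noteq> 0" using L by auto
          have "norm (char (distr (M p) borel (\<lambda>\<omega>. log B (?Y \<omega>))) (2 * pi * of_int l)) =
              (\<Prod>m=1..n. norm (mellin_coeff B (f (p m)) (- l)))"
            unfolding dist
            by (subst char_log_product[where f="\<lambda>m. f (p m)", OF indp])
               (use dens pI B in \<open>auto simp: prod_norm\<close>)
          also have "\<dots> \<le> (\<Prod>m=1..n. \<rho>)" using gap[OF pI l] by (intro prod_mono) auto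
          also have "\<dots> < \<delta>" using elim by simp
          finally show "norm (char (distr (M p) borel (\<lambda>\<omega>. log B (?Y \<omega>))) (2 * pi * of_int l)) < \<delta>" .
        qed
      qed
    qed
  qed
qed

theorem theorem2p2:
  fixes I :: "'i set"
    and D :: "'i \<Rightarrow> real measure"
    and f :: "'i \<Rightarrow> real \<Rightarrow> real"
    and \<alpha> :: "'i \<Rightarrow> real"
    and B :: real
  assumes "finite I"
    and "\<And>j. j \<in> I \<Longrightarrow> has_density_on_nonneg (D j) (f j)"
    and "\<And>j. j \<in> I \<Longrightarrow> 0 < \<alpha> j \<and> \<alpha> j \<le> 1"
    and "\<And>j. j \<in> I \<Longrightarrow> holder_continuous_on (\<alpha> j) {0..} (f j)"
    and "\<And>j x. j \<in> I \<Longrightarrow> x > 1 \<Longrightarrow> f j x = 0"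
    and "B > 1"
  shows "mellin_transform_condition B I f \<and>
    (\<forall>(M :: (nat \<Rightarrow> 'i) \<Rightarrow> 'a measure) (X :: (nat \<Rightarrow> 'i) \<Rightarrow> nat \<Rightarrow> 'a \<Rightarrow> real).
       (\<forall>p \<in> {1..} \<rightarrow>\<^sub>E I. independent_sequence_with_laws (M p) (X p) (\<lambda>m. D (p m))) \<longrightarrow>
       (\<forall>s \<in> {1..<B}.
          (\<lambda>n. SUP p \<in> {1..} \<rightarrow>\<^sub>E I. ennreal
             \<bar>measure (M p) {\<omega> \<in> space (M p). significand B (\<Prod>m=1..n. X p m \<omega>) \<le> s} - log B s\<bar>)
          \<longlonglongrightarrow> 0))"
proof -
  obtain K \<beta> \<rho> where K: "0 \<le> K" "0 < \<beta>" "0 < \<rho>" "\<rho> < 1"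
    "\<And>j l. j \<in> I \<Longrightarrow> l \<noteq> 0 \<Longrightarrow> norm (mellin_coeff B (f j) l) \<le> K * \<bar>of_int l\<bar> powr (-\<beta>)"
    "\<And>j l. j \<in> I \<Longrightarrow> l \<noteq> 0 \<Longrightarrow> norm (mellin_coeff B (f j) l) \<le> \<rho>"
    using uniform_mellin_coeff_bounds[where f=f and D=D and \<alpha>=\<alpha>, OF assms] by blast
  have "(\<lambda>n. SUP p \<in> {1..} \<rightarrow>\<^sub>E I. ennreal
             \<bar>measure (M p) {\<omega> \<in> space (M p). significand B (\<Prod>m=1..n. X p m \<omega>) \<le> s} - log B s\<bar>)
          \<longlonglongrightarrow> 0"
    if ind: "\<forall>p \<in> {1..} \<rightarrow>\<^sub>E I. independent_sequence_with_laws (M p) (X p) (\<lambda>m. D (p m))"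
      and s: "s \<in> {1..<B}"
    for M :: "(nat \<Rightarrow> 'i) \<Rightarrow> 'a measure" and X s
  proof (rule order_tendstoI)
    fix e :: ennreal assume "0 < e"
    then obtain \<epsilon> where \<epsilon>: "0 < ennreal \<epsilon>" "ennreal \<epsilon> < e"
      by (metis dense ennreal_cases not_less_iff_gr_or_eq top.not_eq_extremum)
    then have "0 < \<epsilon>" by simp
    have "\<forall>\<^sub>F n in sequentially. \<forall>p \<in> {1..} \<rightarrow>\<^sub>E I.
       \<bar>measure (M p) {\<omega> \<in> space (M p). significand B (\<Prod>m=1..n. X p m \<omega>) \<le> s} - log B s\<bar> < \<epsilon>"
      using uniformly_benford_of_spectral_gap[where f=f, OF \<open>B > 1\<close> K(3,4) assms(2) K(6) _ s \<open>0 < \<epsilon>\<close>] ind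
      by blast
    then show "\<forall>\<^sub>F n in sequentially. (SUP p \<in> {1..} \<rightarrow>\<^sub>E I. ennreal
             \<bar>measure (M p) {\<omega> \<in> space (M p). significand B (\<Prod>m=1..n. X p m \<omega>) \<le> s} - log B s\<bar>) < e"
    proof eventually_elim
      case (elim n)
      have "(SUP p \<in> {1..} \<rightarrow>\<^sub>E I. ennreal
             \<bar>measure (M p) {\<omega> \<in> space (M p). significand B (\<Prod>m=1..n. X p m \<omega>) \<le> s} - log B s\<bar>) \<le> ennreal \<epsilon>"
        using elim by (intro SUP_least ennreal_leI) (auto intro: less_imp_le)
      then show ?case using \<epsilon>(2) by simp
    qed
  qed simp
  moreover have "mellin_transform_condition B I f"
    using K by (rule mellin_transform_condition_of_bounds)
  ultimately show ?thesis by simp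
qed

end
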